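(* Let $n\ge 3$, $m\ge 3$ and let $\mathcal{S}_{\mathbf W}=\sum_{i=1}^n \mathbf w_i^{\circ m}\in T^m(\mathbb R^{n-1})$ be the regular simplex tensor of order $m$ and dimension $n-1$ generated by the regular simplex frame $\mathbf W=(\mathbf w_1,\dots,\mathbf w_n)$. Then the following hold. (1) If $(m,n)=(3,3)$, $(3,4)$ or $(4,3)$, then $\mathcal S_{\mathbf W}$ has no robust eigenpairs, either among the vectors in the regular simplex frame or elsewhere. (2) For all other combinations $(m,n)$ with $n\ge 3$, $m\ge 3$, the only robust eigenvectors of $\mathcal S_{\mathbf W}$, considered up to sign equivalence, are the vectors $\mathbf w_1,\dots,\mathbf w_n$ of the regular simplex frame.
   Context: $T^m(\mathbb R^{p})$ is the space of real symmetric tensors of order $m$ and dimension $p$. For $\mathcal S\in T^m(\mathbb R^p)$ and $\mathbf v\in\mathbb R^p$: $\mathcal S\mathbf v^m=\sum s_{i_1\dots i_m}v_{i_1}\cdots v_{i_m}$; $\mathcal S\mathbf v^{m-1}\in\mathbb R^p$ has entries $\sum_{i_2,\dots,i_m}s_{j,i_2,\dots,i_m}v_{i_2}\cdots v_{i_m}$; $\mathcal S\mathbf v^{m-2}\in\mathbb R^{p\times p}$ has entries $\sum_{i_3,\dots,i_m}s_{i,j,i_3,\dots,i_m}v_{i_3}\cdots v_{i_m}$. Regular simplex frame: vectors $\mathbf w_1,\dots,\mathbf w_n\in\mathbb R^{n-1}$ with $\|\mathbf w_i\|=1$, $\mathbf w_i^{\mathrm T}\mathbf w_j=-\frac1{n-1}$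 for $i\ne j$, and $\mathbf W\mathbf W^{\mathrm T}=\frac{n}{n-1}\mathbf I_{n-1}$ where $\mathbf W=(\mathbf w_1,\dots,\mathbf w_n)\in\mathbb R^{(n-1)\times n}$. The regular simplex tensor is $\mathcal S_{\mathbf W}=\sum_{i=1}^n\mathbf w_i^{\circ m}$ ($m$-fold outer powers), so $\mathcal S_{\mathbf W}\mathbf v^m=\sum_i(\mathbf w_i^{\mathrm T}\mathbf v)^m$. Eigenpairs are real (Z-)eigenpairs: $(\lambda,\mathbf v)\in\mathbb R\times\mathbb R^p$ with $\mathcal S\mathbf v^{m-1}=\lambda\mathbf v$ and $\mathbf v^{\mathrm T}\mathbf v=1$. Sign equivalence: $(\lambda,\mathbf v)$ and $((-1)^{m-2}\lambda,-\mathbf v)$ are both eigenpairs or both not, and are identified; for $\mathcal S_{\mathbf W}$ a representative with $\lambda\ge 0$ is always chosen (for even $m$ every eigenvalue is $\geq 0$ and $\pm\mathbf v$ are identified). Robustness is defined only for eigenpairs with $\lambda>0$. Such an eigenpair $(\lambda,\mathbf v)$ is robust if $\mathbf v$ is an attracting fixed point of the tensor power iteration $\mathbf v\mapsto \mathcal S\mathbf v^{m-1}/\|\mathcal S\mathbf v^{m-1}\|$, meaning that the spectral radius of its Jacobian $\mathbf J=\frac{m-1}{\lambda}\left(\mathcal S\mathbf v^{m-2}-\lambda\mathbf v\mathbf v^{\mathrm T}\right)$ satisfies $\rho(\mathbf J)<1$; $\mathbf v$ is then called a robust eigenvector. *)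

theory Defs
  imports "Jordan_Normal_Form.Spectral_Radius"
begin

(* A tensor of order m and dimension p is a function on index lists; only its values on
   tensor_idx m p are entries of the tensor. Indices run from 0 to p - 1. *)

type_synonym tensor = "nat list \<Rightarrow> real"

definition tensor_idx :: "nat \<Rightarrow> nat \<Rightarrow> nat list set" where
  "tensor_idx m p = {is. length is = m \<and> set is \<subseteq> {..<p}}"

definition sym_tensors :: "nat \<Rightarrow> nat \<Rightarrow> tensor set" where
  "sym_tensors m p = {S. \<forall>is\<in>tensor_idx m p. \<forall>js. mset js = mset is \<longrightarrow> S js = S is}"

definition tensor_vec :: "nat \<Rightarrow> nat \<Rightarrow> tensor \<Rightarrow> real vec \<Rightarrow> real vec" where
  "tensor_vec m p S v =
     vec p (\<lambda>j. \<Sum>is\<in>tensor_idx (m - 1) p. S (j # is) * (\<Prod>k<m - 1. v $ (is ! k)))"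

definition tensor_mat :: "nat \<Rightarrow> nat \<Rightarrow> tensor \<Rightarrow> real vec \<Rightarrow> real mat" where
  "tensor_mat m p S v =
     mat p p (\<lambda>(i, j). \<Sum>is\<in>tensor_idx (m - 2) p. S (i # j # is) * (\<Prod>k<m - 2. v $ (is ! k)))"

definition outer_power :: "nat \<Rightarrow> real vec \<Rightarrow> tensor" where
  "outer_power m w = (\<lambda>is. \<Prod>k<m. w $ (is ! k))"

definition regular_simplex_frame :: "nat \<Rightarrow> real mat \<Rightarrow> bool" where
  "regular_simplex_frame n W \<longleftrightarrow>
     W \<in> carrier_mat (n - 1) n \<and>
     (\<forall>i<n. sqrt (col W i \<bullet> col W i) = 1) \<and>
     (\<forall>i<n. \<forall>j<n. i \<noteq> j \<longrightarrow> col W i \<bullet> col W j = - 1 / (real n - 1)) \<and>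
     W * transpose_mat W = (real n / (real n - 1)) \<cdot>\<^sub>m 1\<^sub>m (n - 1)"

definition simplex_tensor :: "nat \<Rightarrow> nat \<Rightarrow> real mat \<Rightarrow> tensor" where
  "simplex_tensor m n W = (\<lambda>is. \<Sum>i<n. outer_power m (col W i) is)"

definition eigenpair :: "nat \<Rightarrow> nat \<Rightarrow> tensor \<Rightarrow> real \<Rightarrow> real vec \<Rightarrow> bool" where
  "eigenpair m p S \<mu> v \<longleftrightarrow>
     v \<in> carrier_vec p \<and> tensor_vec m p S v = \<mu> \<cdot>\<^sub>v v \<and> v \<bullet> v = 1"

(* The two representatives of the same eigenpair. *)
definition sign_equivalent :: "nat \<Rightarrow> real \<times> real vec \<Rightarrow> real \<times> real vec \<Rightarrow> bool" where
  "sign_equivalent m = (\<lambda>(\<mu>, v) (\<nu>, u).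
     (\<nu> = \<mu> \<and> u = v) \<or> (\<nu> = (- 1) ^ (m - 2) * \<mu> \<and> u = - v))"

(* The Jacobian of v |-> S v^(m-1) / |S v^(m-1)| at an eigenpair (\<mu>, v) with \<mu> > 0. *)
definition power_jacobian :: "nat \<Rightarrow> nat \<Rightarrow> tensor \<Rightarrow> real \<Rightarrow> real vec \<Rightarrow> real mat" where
  "power_jacobian m p S \<mu> v =
     ((real m - 1) / \<mu>) \<cdot>\<^sub>m (tensor_mat m p S v - \<mu> \<cdot>\<^sub>m mat p p (\<lambda>(i, j). v $ i * v $ j))"

definition robust_eigenpair :: "nat \<Rightarrow> nat \<Rightarrow> tensor \<Rightarrow> real \<Rightarrow> real vec \<Rightarrow> bool" where
  "robust_eigenpair m p S \<mu> v \<longleftrightarrow>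
     eigenpair m p S \<mu> v \<and> 0 < \<mu> \<and>
     spectral_radius (map_mat complex_of_real (power_jacobian m p S \<mu> v)) < 1"

definition robust_eigenvector :: "nat \<Rightarrow> nat \<Rightarrow> tensor \<Rightarrow> real vec \<Rightarrow> bool" where
  "robust_eigenvector m p S v \<longleftrightarrow> (\<exists>\<mu>. robust_eigenpair m p S \<mu> v)"

lemma outer_power_conv_prod_mset:
  assumes "length is = m"
  shows "outer_power m w is = prod_mset (image_mset (($) w) (mset is))"
proof -
  have "outer_power m w is = (\<Prod>k<length (map (($) w) is). map (($) w) is ! k)"
    using assms by (simp add: outer_power_def)
  also have "\<dots> = prod_list (map (($) w) is)"
    by (simp add: prod.list_conv_set_nth atLeast0LessThan)
  finally show ?thesis
    by (simp flip: prod_mset_prod_list)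
qed

lemma simplex_tensor_sym: "simplex_tensor m n W \<in> sym_tensors m p"
proof -
  have "outer_power m w js = outer_power m w is"
    if "length is = m" and "mset js = mset is" for w "is" js
    using that by (metis outer_power_conv_prod_mset mset_eq_length)
  then show ?thesis
    by (auto simp: sym_tensors_def tensor_idx_def simplex_tensor_def intro!: sum.cong)
qed

end

theory Submission
  imports Defs
begin

text \<open>
  For an eigenpair \<open>(\<mu>, v)\<close> with \<open>\<mu> > 0\<close>, the coordinates \<open>a\<^sub>i = w\<^sub>i \<bullet> v\<close> sum to zero and are all roots of
  \<open>f(t) = n t ^ (m - 1) - (n - 1) \<mu> t - c\<close> for one constant \<open>c\<close>. The vector \<open>\<Sum> b\<^sub>i w\<^sub>i\<close> is an eigenvector of
  the Jacobian as soon as \<open>b\<close> and \<open>a\<close> are orthogonal, \<open>b\<close> sums to zero and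
  \<open>a\<^sub>i ^ (m - 2) b\<^sub>i = \<theta> b\<^sub>i + const\<close>; robustness then bounds \<open>\<theta>\<close>. With \<open>b = e\<^sub>i - e\<^sub>j\<close> this forces
  \<open>f' < 0\<close> at repeated coordinates, so at most one of two values is repeated, while Rolle's theorem
  allows at most three values. In the remaining case of three values, of which only the middle one can
  be repeated, the block-constant test vector makes \<open>f[\<alpha>,\<alpha>,\<beta>,\<beta>,\<gamma>,\<gamma>]\<close> negative, although this divided
  difference is a value of the fifth derivative of \<open>f\<close> divided by 120, hence nonnegative for even \<open>m\<close>.
  So \<open>v\<close> is a frame vector up to sign, and there the Jacobian is a multiple of the projection
  \<open>1 - w w\<^sup>T\<close>, with spectral radius \<open>(m - 1) n / ((n - 1) ^ (m - 1) + (- 1) ^ m)\<close>.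
\<close>

section \<open>Rolle's theorem and Hermite interpolation for real polynomials\<close>

lemma poly_Rolle:
  fixes p :: "real poly"
  assumes "x < y" "poly p x = poly p y"
  shows "\<exists>z. x < z \<and> z < y \<and> poly (pderiv p) z = 0"
  using poly_MVT[OF assms(1), of p] assms by auto

lemma poly_Rolle_list:
  fixes p :: "real poly"
  assumes "xs \<noteq> []" "sorted_wrt (<) xs" "\<forall>x\<in>set xs. poly p x = 0"
  shows "\<exists>ys. length xs = Suc (length ys) \<and> sorted_wrt (<) ys \<and>
           (\<forall>y\<in>set ys. hd xs < y \<and> poly (pderiv p) y = 0)"
  using assms
proof (induction xs rule: induct_list012)
  case (2 x)
  show ?case by (intro exI[of _ "[]"]) simp
next
  case (3 x y xs)
  then obtain ys where ys: "length (y # xs) = Suc (length ys)" "sorted_wrt (<) ys"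
    "\<forall>z\<in>set ys. y < z \<and> poly (pderiv p) z = 0"
    by auto
  obtain z where z: "x < z" "z < y" "poly (pderiv p) z = 0"
    using poly_Rolle[of x y p] 3 by auto
  show ?case
    using ys z by (intro exI[of _ "z # ys"]) (auto dest: less_trans)
qed simp

lemma poly_Rolle_iterate:
  fixes p :: "real poly"
  assumes "length xs = Suc k" "sorted_wrt (<) xs" "\<forall>x\<in>set xs. poly p x = 0"
  shows "\<exists>y. poly ((pderiv ^^ k) p) y = 0"
  using assms
proof (induction k arbitrary: p xs)
  case 0
  thus ?case by (cases xs) auto
next
  case (Suc k)
  have "xs \<noteq> []" using Suc.prems by auto
  from poly_Rolle_list[OF this Suc.prems(2,3)]
  obtain ys where "length xs = Suc (length ys)" "sorted_wrt (<) ys"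
    "\<forall>y\<in>set ys. poly (pderiv p) y = 0"
    by blast
  thus ?case using Suc.IH[of ys "pderiv p"] Suc.prems unfolding funpow_Suc_right comp_apply by simp
qed

text \<open>The sum in the conclusion is the divided difference of
  \<open>n t ^ M - L t - k\<close> with each root doubled, up to a positive factor: it is the leading coefficient of
  the quintic Hermite interpolant \<open>H\<close>.\<close>

lemma hermite_three_roots:
  fixes a b c n L k :: real and M :: nat
  assumes ab: "a < b" and bc: "b < c" and M: "odd M" and n: "n \<ge> 0"
    and roots: "n * a ^ M = L * a + k" "n * b ^ M = L * b + k" "n * c ^ M = L * c + k"
  defines "d \<equiv> \<lambda>t. n * (real M * t ^ (M - 1)) - L"
  shows "0 \<le> d a * (c - b)\<^sup>2 + d b * (c - a)\<^sup>2 + d c * (b - a)\<^sup>2"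
proof (rule ccontr)
  assume neg: "\<not> ?thesis"
  define A where "A = d a / ((b - a)\<^sup>2 * (c - a)\<^sup>2)"
  define B where "B = d b / ((b - a)\<^sup>2 * (c - b)\<^sup>2)"
  define C where "C = d c / ((c - a)\<^sup>2 * (c - b)\<^sup>2)"
  have dA: "d a = A * ((b - a)\<^sup>2 * (c - a)\<^sup>2)" and dB: "d b = B * ((b - a)\<^sup>2 * (c - b)\<^sup>2)"
    and dC: "d c = C * ((c - a)\<^sup>2 * (c - b)\<^sup>2)"
    using ab bc by (simp_all add: A_def B_def C_def)
  have "d a * (c - b)\<^sup>2 + d b * (c - a)\<^sup>2 + d c * (b - a)\<^sup>2
      = (A + B + C) * ((b - a) * (c - a) * (c - b))\<^sup>2"
    unfolding dA dB dC power_mult_distrib by (simp add: algebra_simps)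
  hence lead: "A + B + C < 0"
    using neg by (simp add: not_le mult_less_0_iff)
  \<comment> \<open>\<open>H\<close> vanishes at the three nodes, and by the choice of
    \<open>A\<close>, \<open>B\<close>, \<open>C\<close> its derivatives there are
    \<open>d a\<close>, \<open>d b\<close>, \<open>d c\<close>. Subtracting it therefore leaves a
    polynomial \<open>P\<close> with double zeros at the nodes.\<close>
  define G where "G = Polynomial.smult A ([:- b, 1:] * [:- c, 1:]) + Polynomial.smult B ([:- a, 1:] * [:- c, 1:])
    + Polynomial.smult C ([:- a, 1:] * [:- b, 1:])"
  define H where "H = [:- a, 1:] * [:- b, 1:] * [:- c, 1:] * G"
  define P where "P = monom n M - [:k, L:] - H"
  have P0: "poly P a = 0" "poly P b = 0" "poly P c = 0"
    using roots by (simp_all add: P_def H_def poly_monom algebra_simps)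
  have P1: "poly (pderiv P) a = 0" "poly (pderiv P) b = 0" "poly (pderiv P) c = 0"
    using dA dB dC
    unfolding P_def H_def G_def d_def
    by (simp_all add: pderiv_diff pderiv_mult pderiv_monom pderiv_pCons poly_monom
        power2_eq_square algebra_simps)
  obtain x where x: "a < x" "x < b" "poly (pderiv P) x = 0"
    using poly_Rolle[OF ab, of P] P0 by auto
  obtain y where y: "b < y" "y < c" "poly (pderiv P) y = 0"
    using poly_Rolle[OF bc, of P] P0 by auto
  let ?D = "pderiv :: real poly \<Rightarrow> real poly"
  \<comment> \<open>The derivative of \<open>P\<close> has five zeros, namely the three nodes and
    one Rolle point in each gap.\<close>
  have "\<exists>t. poly ((?D ^^ 4) (?D P)) t = 0"
    by (rule poly_Rolle_iterate[of "[a, x, b, y, c]"]) (use P1 x y ab bc in auto)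
  hence "\<exists>t. poly ((?D ^^ 5) P) t = 0"
    by (simp add: funpow_swap1 numeral_eq_Suc)
  then obtain t where t: "poly ((?D ^^ 5) P) t = 0" ..
  have "(?D ^^ 5) P = (?D ^^ 5) (monom n M) - (?D ^^ 5) [:k, L:] - (?D ^^ 5) H"
    by (simp add: P_def numeral_eq_Suc pderiv_diff)
  moreover have "(?D ^^ 5) [:k, L:] = 0"
    by (simp add: numeral_eq_Suc pderiv_pCons)
  moreover have "(?D ^^ 5) H = [:120 * (A + B + C):]"
    by (simp add: H_def G_def numeral_eq_Suc pderiv_pCons algebra_simps)
  \<comment> \<open>For odd \<open>M\<close> this derivative is zero or carries the even exponent
    \<open>M - 5\<close>. The one of \<open>H\<close> is 5! times its negative leading coefficient,
    so the difference cannot vanish.\<close>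
  moreover have "poly ((?D ^^ 5) (monom n M)) t \<ge> 0"
  proof (cases "M \<ge> 5")
    case True
    hence "even (M - 5)" using M by simp
    hence "t ^ (M - 5) \<ge> 0" by (rule zero_le_even_power)
    thus ?thesis using n
      by (simp add: numeral_eq_Suc pderiv_monom poly_monom)
  next
    case False
    hence "M = 1 \<or> M = 3" using M by presburger
    thus ?thesis by (auto simp: numeral_eq_Suc pderiv_monom)
  qed
  ultimately show False using t lead by simp
qed

section \<open>Coordinate vectors that satisfy the robustness condition\<close>

lemma pos_power_eq_inj:
  assumes "s ^ k = K" "t ^ k = K" "s < t" "k > 0" "K > (0::real)"
  shows "s = - t \<and> t > 0 \<and> even k"
proof -
  have "\<bar>s\<bar> ^ k = \<bar>t\<bar> ^ k" using assms by (simp flip: power_abs)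
  hence "\<bar>s\<bar> = \<bar>t\<bar>" using assms power_eq_imp_eq_base[of "\<bar>s\<bar>" k "\<bar>t\<bar>"] by simp
  hence st: "s = - t" "t > 0" using assms by auto
  moreover have "even k"
  proof (rule ccontr)
    assume "odd k"
    thus False using st assms by (simp add: power_minus_odd)
  qed
  ultimately show ?thesis by simp
qed

lemma sum_two_special:
  fixes x y z :: real
  assumes "p < n" "q < n" "p \<noteq> q"
  shows "(\<Sum>i<n. if i = p then x else if i = q then y else z) = x + y + (real n - 2) * z"
proof -
  have "(\<Sum>i<n. if i = p then x else if i = q then y else z)
      = x + (\<Sum>i\<in>{..<n} - {p}. if i = q then y else z)"
    using assms by (subst sum.remove[of _ p]) (auto intro!: sum.cong)
  also have "(\<Sum>i\<in>{..<n} - {p}. if i = q then y else z) = y + (\<Sum>i\<in>{..<n} - {p} - {q}. z)"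
    using assms by (subst sum.remove[of _ q]) (auto intro!: sum.cong)
  also have "(\<Sum>i\<in>{..<n} - {p} - {q}. z) = (real n - 2) * z"
    using assms by (simp add: card_Diff_singleton_if of_nat_diff)
  finally show ?thesis by simp
qed

text \<open>The last assumption is the robustness condition for the test vector with coefficients \<open>b\<close>;
  \<open>L\<close> stands for \<open>(n - 1) \<mu>\<close>.\<close>

locale stable_values =
  fixes n m :: nat and L c :: real and a :: "nat \<Rightarrow> real"
  assumes n: "n \<ge> 3" and m: "m \<ge> 3" and L: "L > 0"
    and roots: "\<And>i. i < n \<Longrightarrow> n * a i ^ (m - 1) = L * a i + c"
    and sum_a: "(\<Sum>i<n. a i) = 0"
    and nz: "\<exists>i<n. a i \<noteq> 0"
    and stab: "\<And>b \<theta> \<mu>. \<exists>i<n. b i \<noteq> 0 \<Longrightarrow> (\<Sum>i<n. b i) = 0 \<Longrightarrow> (\<Sum>i<n. a i * b i) = 0 \<Longrightarrow>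
      (\<And>i. i < n \<Longrightarrow> a i ^ (m - 2) * b i = \<theta> * b i + \<mu>) \<Longrightarrow> real (m - 1) * n * \<bar>\<theta>\<bar> < L"
begin

text \<open>The test vector \<open>e_i - e_j\<close> is orthogonal to \<open>a\<close> because the
  two values agree; it has \<open>\<theta> = a i ^ (m - 2)\<close> and additive constant 0.\<close>

lemma stable_repeated_value:
  assumes "i < n" "j < n" "i \<noteq> j" "a i = a j"
  shows "real (m - 1) * n * \<bar>a i\<bar> ^ (m - 2) < L"
proof -
  let ?b = "\<lambda>l. if l = i then 1 else if l = j then - 1 else (0::real)"
  have "(\<Sum>l<n. a l * ?b l) = (\<Sum>l<n. if l = i then a i else if l = j then - a j else 0)"
    by (intro sum.cong) auto
  hence "(\<Sum>l<n. a l * ?b l) = 0" using assms by (simp add: sum_two_special)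
  moreover have "\<exists>l<n. ?b l \<noteq> 0" using assms by (intro exI[of _ i]) simp
  moreover have "(\<Sum>l<n. ?b l) = 0" using assms by (simp add: sum_two_special)
  ultimately show ?thesis
    using stab[of ?b "a i ^ (m - 2)" 0] assms by (auto simp: power_abs)
qed

text \<open>The critical points of \<open>n t ^ (m - 1) - L t - c\<close> are the solutions of
  \<open>t ^ (m - 2) = crit\<close>.\<close>

definition "crit = L / (real (m - 1) * n)"

lemma crit_pos: "crit > 0"
  using L n m by (simp add: crit_def)

text \<open>A second index with the value \<open>x\<close> would contradict
  \<open>stable_repeated_value\<close>.\<close>

lemma unique_index:
  assumes "x \<in> a ` {..<n}" "crit \<le> \<bar>x\<bar> ^ (m - 2)"
  shows "\<exists>k<n. a k = x \<and> (\<forall>i<n. i \<noteq> k \<longrightarrow> a i \<noteq> x)"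
proof -
  obtain k where k: "k < n" "a k = x" using assms by auto
  have pos: "real (m - 1) * n > 0" using m n by simp
  have "a i \<noteq> x" if "i < n" "i \<noteq> k" for i
  proof
    assume "a i = x"
    hence "real (m - 1) * n * \<bar>x\<bar> ^ (m - 2) < L"
      using stable_repeated_value[of k i] k that by auto
    also have "L \<le> real (m - 1) * n * \<bar>x\<bar> ^ (m - 2)"
      using assms(2) unfolding crit_def pos_divide_le_eq[OF pos] by (simp only: mult_ac)
    finally show False by simp
  qed
  thus ?thesis using k by blast
qed

lemma critical_point_between:
  assumes "x \<in> a ` {..<n}" "y \<in> a ` {..<n}" "x < y"
  shows "\<exists>z. x < z \<and> z < y \<and> z ^ (m - 2) = crit"
proof -
  let ?p = "monom (real n) (m - 1) - [:c, L:]"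
  have "poly ?p x = 0" "poly ?p y = 0"
    using assms roots by (force simp: poly_monom)+
  then obtain z where z: "x < z" "z < y" "poly (pderiv ?p) z = 0"
    using poly_Rolle[of x y ?p] assms by auto
  have pos: "real (m - 1) * n > 0" using m n by simp
  have "m - 1 - 1 = m - 2" by simp
  hence "real (m - 1) * n * z ^ (m - 2) = L"
    using z(3) by (simp only: pderiv_diff pderiv_monom) (simp add: pderiv_pCons poly_monom mult_ac)
  hence "z ^ (m - 2) = crit"
    using pos unfolding crit_def by (metis nonzero_mult_div_cancel_left less_irrefl)
  thus ?thesis using z by blast
qed

text \<open>Each of the two gaps contains a critical point. Two distinct real solutions of
  \<open>t ^ (m - 2) = crit\<close> are opposite, and then the exponent is even.\<close>

lemma critical_point_between2:
  assumes "x \<in> a ` {..<n}" "y \<in> a ` {..<n}" "z \<in> a ` {..<n}" "x < y" "y < z"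
  shows "\<exists>t>0. x < - t \<and> - t < y \<and> y < t \<and> t < z \<and> t ^ (m - 2) = crit \<and> even m"
proof -
  obtain s t where st: "x < s" "s < y" "y < t" "t < z" "s ^ (m - 2) = crit" "t ^ (m - 2) = crit"
    using critical_point_between[of x y] critical_point_between[of y z] assms by auto
  have "s = - t \<and> t > 0 \<and> even (m - 2)"
    using pos_power_eq_inj[of s "m - 2" crit t] st m crit_pos by auto
  thus ?thesis using st m by (intro exI[of _ t]) auto
qed

text \<open>For four values \<open>x < y < z < w\<close>, the lower triple yields \<open>t\<close>
  with \<open>- t < y\<close> and \<open>t < z\<close>, the upper one \<open>t'\<close> with
  \<open>y < - t'\<close> and \<open>z < t'\<close>. Then \<open>t < t'\<close> and
  \<open>t' < t\<close>.\<close>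

lemma card_values_le: "card (a ` {..<n}) \<le> 3"
proof (rule ccontr)
  assume gt: "\<not> ?thesis"
  let ?V = "sorted_list_of_set (a ` {..<n})"
  have "length ?V \<ge> 4" using gt by simp
  then obtain x y z w ws where V: "?V = x # y # z # w # ws"
    by (auto simp: numeral_eq_Suc Suc_le_length_iff simp del: length_sorted_list_of_set)
  have "set ?V = a ` {..<n}" "sorted_wrt (<) ?V" by simp_all
  hence "{x, y, z, w} \<subseteq> a ` {..<n}" "x < y" "y < z" "z < w" unfolding V by auto
  thus False
    using critical_point_between2[of x y z] critical_point_between2[of y z w] by fastforce
qed

text \<open>A critical point lies between the two values, so one of them is at least as large in
  modulus and hence occurs only once. The zero sum then determines the other value.\<close>

lemma two_values:
  assumes V: "a ` {..<n} = {r, s}" and rs: "r < s"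
  shows "\<exists>k<n. \<forall>i<n. i \<noteq> k \<longrightarrow> a i = - a k / (real n - 1)"
proof -
  obtain z where z: "r < z" "z < s" "z ^ (m - 2) = crit"
    using critical_point_between[of r s] V rs by auto
  have "crit = \<bar>z\<bar> ^ (m - 2)"
    using z(3) crit_pos by (metis abs_of_pos power_abs)
  moreover have "\<bar>z\<bar> \<le> \<bar>r\<bar> \<or> \<bar>z\<bar> \<le> \<bar>s\<bar>" using z by linarith
  ultimately obtain x where "x \<in> {r, s}" "crit \<le> \<bar>x\<bar> ^ (m - 2)"
    using power_mono[of "\<bar>z\<bar>"] by fastforce
  then obtain k where k: "k < n" "\<forall>i<n. i \<noteq> k \<longrightarrow> a i \<noteq> a k"
    using unique_index[of x] V by auto
  define y where "y = (if a k = r then s else r)"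
  have y: "a i = y" if "i < n" "i \<noteq> k" for i
    using k that V by (auto simp: y_def)
  have "0 = a k + (\<Sum>i\<in>{..<n} - {k}. a i)"
    using sum_a k by (simp add: sum.remove[of _ k])
  also have "(\<Sum>i\<in>{..<n} - {k}. a i) = (real n - 1) * y"
    using y k n by (simp add: of_nat_diff)
  finally have "y = - a k / (real n - 1)" using n by (simp add: field_simps)
  thus ?thesis using k y by blast
qed

text \<open>The outer values lie beyond the critical points and occur once each, which leaves
  \<open>n - 2\<close> copies of \<open>s\<close>. A test vector constant on these three blocks
  gives a contradiction to \<open>hermite_three_roots\<close>.\<close>

lemma not_three_values:
  assumes V: "a ` {..<n} = {r, s, t}" and rs: "r < s" and st: "s < t"
  shows False
proof -
  obtain z where z: "z > 0" "r < - z" "z < t" "z ^ (m - 2) = crit" "even m"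
    using critical_point_between2[of r s t] assms by auto
  have "crit \<le> \<bar>r\<bar> ^ (m - 2)" "crit \<le> \<bar>t\<bar> ^ (m - 2)"
    using z power_mono[of z "\<bar>r\<bar>" "m - 2"] power_mono[of z "\<bar>t\<bar>" "m - 2"] by auto
  then obtain p q where p: "p < n" "a p = r" "\<forall>i<n. i \<noteq> p \<longrightarrow> a i \<noteq> r"
    and q: "q < n" "a q = t" "\<forall>i<n. i \<noteq> q \<longrightarrow> a i \<noteq> t"
    using unique_index[of r] unique_index[of t] V by auto
  have pq: "p \<noteq> q" using p q rs st by auto
  have a: "a i = (if i = p then r else if i = q then t else s)" if "i < n" for i
    using p q that V by auto
  define N where "N = real n - 2"
  have N: "N \<ge> 1" using n by (simp add: N_def)
  have split: "(\<Sum>i<n. if i = p then x else if i = q then y else w) = x + y + N * w" for x y w :: real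
    unfolding N_def using sum_two_special p q pq by auto
  have "(\<Sum>i<n. a i) = (\<Sum>i<n. if i = p then r else if i = q then t else s)"
    using a by (intro sum.cong) auto
  hence sum0: "r + t + N * s = 0"
    unfolding split using sum_a by simp
  define R T S where "R = r ^ (m - 2)" and "T = t ^ (m - 2)" and "S = s ^ (m - 2)"
  \<comment> \<open>Up to scaling, the only vector constant on the blocks that is orthogonal to both \<open>a\<close> and \<open>1\<close>.\<close>
  define bp bq bo where "bp = N * (s - t)" and "bq = N * (r - s)" and "bo = t - r"
  define b where "b i = (if i = p then bp else if i = q then bq else bo)" for i
  have b0: "bp + bq + N * bo = 0"
    by (simp add: bp_def bq_def bo_def algebra_simps)
  have ab0: "r * bp + t * bq + N * (s * bo) = 0"
    by (simp add: bp_def bq_def bo_def algebra_simps)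
  have pw: "x ^ (m - 1) = x ^ (m - 2) * x" for x :: real
  proof -
    have "m - 1 = Suc (m - 2)" using m by simp
    thus ?thesis by (simp only: power_Suc2)
  qed
  have "s \<in> a ` {..<n}" using V by simp
  then obtain o1 where o1: "o1 < n" "a o1 = s" by auto
  have eqs: "n * (R * r) = L * r + c" "n * (T * t) = L * t + c" "n * (S * s) = L * s + c"
    using roots[OF p(1)] roots[OF q(1)] roots[OF o1(1)]
    unfolding pw p(2) q(2) o1(2) R_def T_def S_def by simp_all
  \<comment> \<open>Subtracting the equation of the middle block eliminates \<open>\<mu>\<close>:
    what is sought is \<open>\<theta>\<close> with \<open>ep = \<theta> * (bp - bo)\<close> and
    \<open>eq = \<theta> * (bq - bo)\<close>. It exists because \<open>(ep, eq)\<close> and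
    \<open>(bp - bo, bq - bo)\<close> are both orthogonal to \<open>(r, t)\<close>, hence
    proportional.\<close>
  define ep eq where "ep = R * bp - S * bo" and "eq = T * bq - S * bo"
  have dp: "bp - bo < 0" and dq: "bq - bo < 0"
    using rs st N mult_nonneg_nonpos[of N "s - t"] mult_nonneg_nonpos[of N "r - s"]
    by (simp_all add: bp_def bq_def bo_def)
  \<comment> \<open>By the root equations \<open>a i ^ (m - 1)\<close> is an affine function of
    \<open>a i\<close>. As \<open>b\<close> is orthogonal to \<open>a\<close> and to 1, it is
    orthogonal to these powers too.\<close>
  have "n * (R * r * bp + T * t * bq + N * (S * s * bo))
      = bp * (n * (R * r)) + bq * (n * (T * t)) + N * bo * (n * (S * s))"
    by (simp add: algebra_simps)
  also have "\<dots> = L * (r * bp + t * bq + N * (s * bo)) + c * (bp + bq + N * bo)"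
    unfolding eqs by (simp add: algebra_simps)
  finally have "n * (R * r * bp + T * t * bq + N * (S * s * bo)) = 0"
    unfolding ab0 b0 by simp
  hence "R * r * bp + T * t * bq + N * (S * s * bo) = 0"
    using n by simp
  moreover have "r * ep + t * eq
      = (R * r * bp + T * t * bq + N * (S * s * bo)) - S * bo * (r + t + N * s)"
    unfolding ep_def eq_def by (simp add: algebra_simps)
  ultimately have e0: "r * ep + t * eq = 0"
    unfolding sum0 by simp
  have "r * (bp - bo) + t * (bq - bo)
      = (r * bp + t * bq + N * (s * bo)) - bo * (r + t + N * s)"
    by (simp add: algebra_simps)
  hence d0: "r * (bp - bo) + t * (bq - bo) = 0"
    unfolding ab0 sum0 by simp
  have "r * (ep * (bq - bo) - eq * (bp - bo))
      = (r * ep + t * eq) * (bq - bo) - eq * (r * (bp - bo) + t * (bq - bo))"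
    by (simp add: algebra_simps)
  moreover have "r \<noteq> 0" using z by auto
  ultimately have ratio: "ep * (bq - bo) = eq * (bp - bo)"
    unfolding e0 d0 by simp
  define \<theta> where "\<theta> = ep / (bp - bo)"
  define \<mu> where "\<mu> = S * bo - \<theta> * bo"
  have th: "ep = \<theta> * (bp - bo)" "eq = \<theta> * (bq - bo)"
    using ratio dp by (auto simp: \<theta>_def field_simps)
  have eig: "R * bp = \<theta> * bp + \<mu>" "T * bq = \<theta> * bq + \<mu>" "S * bo = \<theta> * bo + \<mu>"
    using th by (auto simp: ep_def eq_def \<mu>_def algebra_simps)
  have "real (m - 1) * n * \<bar>\<theta>\<bar> < L"
  proof (rule stab[of b \<theta> \<mu>])
    show "\<exists>i<n. b i \<noteq> 0" using p rs st N by (intro exI[of _ p]) (auto simp: b_def bp_def)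
    show "(\<Sum>i<n. b i) = 0" unfolding b_def split using b0 by simp
    have "(\<Sum>i<n. a i * b i) = (\<Sum>i<n. if i = p then r * bp else if i = q then t * bq else s * bo)"
      using a by (intro sum.cong) (auto simp: b_def)
    thus "(\<Sum>i<n. a i * b i) = 0" unfolding split using ab0 by simp
    show "a i ^ (m - 2) * b i = \<theta> * b i + \<mu>" if "i < n" for i
      using eig a that by (auto simp: b_def R_def T_def S_def)
  qed
  moreover have "real (m - 1) * n * \<theta> \<le> real (m - 1) * n * \<bar>\<theta>\<bar>"
    by (intro mult_left_mono) auto
  ultimately have lt: "real (m - 1) * n * \<theta> < L" by linarith
  \<comment> \<open>\<open>B\<close> is the squared norm of \<open>b\<close>. Pairing the eigenvalue
    equation with \<open>b\<close> removes \<open>\<mu>\<close> and turns the bound on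
    \<open>\<theta>\<close> into a bound on a quadratic form.\<close>
  define B where "B = bp\<^sup>2 + bq\<^sup>2 + N * bo\<^sup>2"
  have "bo\<^sup>2 > 0" using rs st by (simp add: bo_def)
  hence "B > 0" using N by (auto simp: B_def intro!: add_nonneg_pos mult_pos_pos)
  have "R * bp\<^sup>2 + T * bq\<^sup>2 + N * (S * bo\<^sup>2) = R * bp * bp + T * bq * bq + N * (S * bo * bo)"
    by (simp add: power2_eq_square)
  also have "\<dots> = \<theta> * B + \<mu> * (bp + bq + N * bo)"
    unfolding B_def eig by (simp add: power2_eq_square algebra_simps)
  finally have "R * bp\<^sup>2 + T * bq\<^sup>2 + N * (S * bo\<^sup>2) = \<theta> * B"
    unfolding b0 by simp
  hence quad: "real (m - 1) * n * (R * bp\<^sup>2 + T * bq\<^sup>2 + N * (S * bo\<^sup>2)) < L * B"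
    using mult_strict_right_mono[OF lt \<open>B > 0\<close>] by (simp add: mult_ac)
  define d where "d x = real n * (real (m - 1) * x ^ (m - 2)) - L" for x :: real
  have "d r * bp\<^sup>2 + d t * bq\<^sup>2 + N * (d s * bo\<^sup>2) < 0"
    using quad unfolding B_def d_def R_def T_def S_def by (simp add: algebra_simps)
  moreover have "d r * bp\<^sup>2 + d t * bq\<^sup>2 = N\<^sup>2 * (d r * (t - s)\<^sup>2 + d t * (s - r)\<^sup>2)"
    unfolding bp_def bq_def power_mult_distrib power2_commute[of s t] power2_commute[of r s]
    by (simp add: algebra_simps)
  \<comment> \<open>The outer terms carry the factor \<open>N\<^sup>2\<close> but the middle one
    only \<open>N\<close>. For \<open>n = 3\<close> both are 1; otherwise \<open>s\<close> is
    repeated, so \<open>d s\<close> is negative and a larger weight only lowers the sum.\<close>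
  moreover have "N\<^sup>2 * (d s * bo\<^sup>2) \<le> N * (d s * bo\<^sup>2)"
  proof (cases "n = 3")
    case False
    have "\<exists>j<n. j \<noteq> o1 \<and> j \<noteq> p \<and> j \<noteq> q"
    proof (rule ccontr)
      assume "\<not> ?thesis"
      hence "{..<n} \<subseteq> {o1, p, q}" by auto
      hence "n \<le> card {o1, p, q}" using card_mono[of "{o1, p, q}" "{..<n}"] by simp
      also have "\<dots> \<le> 3" by (simp add: card_insert_if)
      finally show False using n False by simp
    qed
    then obtain j where "j < n" "j \<noteq> o1" "j \<noteq> p" "j \<noteq> q" by blast
    hence "real (m - 1) * n * \<bar>s\<bar> ^ (m - 2) < L"
      using stable_repeated_value[of o1 j] o1 a[of j] by auto
    moreover have "\<bar>s\<bar> ^ (m - 2) = s ^ (m - 2)" using z by (simp add: power_even_abs)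
    ultimately have "d s * bo\<^sup>2 \<le> 0"
      by (auto simp: d_def mult_ac mult_le_0_iff)
    moreover have "N \<le> N\<^sup>2" using N by (simp add: power2_eq_square)
    ultimately show ?thesis by (rule mult_right_mono_neg[rotated])
  qed (simp add: N_def)
  ultimately have "N\<^sup>2 * (d r * (t - s)\<^sup>2 + d s * (t - r)\<^sup>2 + d t * (s - r)\<^sup>2) < 0"
    unfolding bo_def by (simp add: algebra_simps)
  moreover have "0 \<le> d r * (t - s)\<^sup>2 + d s * (t - r)\<^sup>2 + d t * (s - r)\<^sup>2"
  proof -
    have "m - 1 - 1 = m - 2" "odd (m - 1)" using m z by auto
    thus ?thesis
      using hermite_three_roots[OF rs st, of "m - 1" n L c] roots[OF p(1)] roots[OF q(1)] roots[OF o1(1)]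
      unfolding d_def p(2) q(2) o1(2) by simp
  qed
  ultimately show False by (simp add: mult_less_0_iff)
qed

lemma stable_configuration:
  "\<exists>k<n. \<forall>i<n. i \<noteq> k \<longrightarrow> a i = - a k / (real n - 1)"
proof -
  let ?V = "sorted_list_of_set (a ` {..<n})"
  have V: "set ?V = a ` {..<n}" "sorted_wrt (<) ?V" by simp_all
  have "length ?V \<le> 3" using card_values_le by simp
  moreover have "length ?V \<noteq> 0" using n by (auto simp: lessThan_empty_iff)
  ultimately consider "length ?V = 1" | "length ?V = 2" | "length ?V = 3" by linarith
  thus ?thesis
  proof cases
    case 1
    then obtain x where "?V = [x]" by (auto simp: length_Suc_conv simp del: length_sorted_list_of_set)
    hence x: "a i = x" if "i < n" for i using V that by auto
    hence "real n * x = 0" using sum_a by simp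
    thus ?thesis using x nz n by auto
  next
    case 2
    then obtain x y where "?V = [x, y]" by (auto simp: length_Suc_conv numeral_eq_Suc simp del: length_sorted_list_of_set)
    thus ?thesis using V two_values[of x y] by auto
  next
    case 3
    then obtain x y z where "?V = [x, y, z]" by (auto simp: length_Suc_conv numeral_eq_Suc simp del: length_sorted_list_of_set)
    thus ?thesis using V not_three_values[of x y z] by auto
  qed
qed

end

section \<open>Contractions of outer powers\<close>

lemma tensor_idx_0: "tensor_idx 0 p = {[]}"
  by (auto simp: tensor_idx_def)

lemma tensor_idx_Suc: "tensor_idx (Suc k) p = (\<lambda>(j, is). j # is) ` ({..<p} \<times> tensor_idx k p)"
  by (auto simp: tensor_idx_def length_Suc_conv image_iff)

lemma sum_prod_tensor_idx:
  fixes g :: "nat \<Rightarrow> real"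
  shows "(\<Sum>is\<in>tensor_idx k p. \<Prod>l<k. g (is ! l)) = (\<Sum>r<p. g r) ^ k"
proof (induction k)
  case (Suc k)
  have inj: "inj_on (\<lambda>(j, is). j # is) ({..<p} \<times> tensor_idx k p)"
    by (auto simp: inj_on_def)
  have "(\<Sum>is\<in>tensor_idx (Suc k) p. \<Prod>l<Suc k. g (is ! l))
      = (\<Sum>(j, is)\<in>{..<p} \<times> tensor_idx k p. g j * (\<Prod>l<k. g (is ! l)))"
    unfolding tensor_idx_Suc sum.reindex[OF inj]
    by (intro sum.cong) (auto simp: prod.lessThan_Suc_shift simp del: prod.lessThan_Suc)
  also have "\<dots> = (\<Sum>r<p. g r) * (\<Sum>is\<in>tensor_idx k p. \<Prod>l<k. g (is ! l))"
    by (simp add: sum_product sum.cartesian_product)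
  finally show ?case using Suc by simp
qed (simp add: tensor_idx_0)

lemma outer_power_Cons: "outer_power (Suc k) w (j # is) = w $ j * outer_power k w is"
  by (simp add: outer_power_def prod.lessThan_Suc_shift del: prod.lessThan_Suc)

text \<open>The sum over all index lists factors by distributivity into \<open>k\<close> copies of
  the scalar product.\<close>

lemma sum_outer_power:
  assumes "v \<in> carrier_vec p"
  shows "(\<Sum>is\<in>tensor_idx k p. outer_power k w is * (\<Prod>l<k. v $ (is ! l))) = (w \<bullet> v) ^ k"
  using assms sum_prod_tensor_idx[of "\<lambda>r. w $ r * v $ r" k p]
  by (simp add: outer_power_def prod.distrib scalar_prod_def atLeast0LessThan)

section \<open>Eigenvalues and spectral radii of real matrices\<close>

lemma eigenvalue_norm_le_spectral_radius:
  fixes A :: "real mat"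
  assumes A: "A \<in> carrier_mat p p" and v: "v \<in> carrier_vec p" "v \<noteq> 0\<^sub>v p"
    and eig: "A *\<^sub>v v = x \<cdot>\<^sub>v v"
  shows "\<bar>x\<bar> \<le> spectral_radius (map_mat complex_of_real A)"
proof -
  have "eigenvalue A x"
    using assms by (auto simp: eigenvalue_def eigenvector_def)
  hence "eigenvalue (map_mat complex_of_real A) (complex_of_real x)"
    by (rule of_real_hom.eigenvalue_hom[OF A])
  moreover have "p > 0" using v by (cases p) auto
  moreover have "map_mat complex_of_real A \<in> carrier_mat p p" using A by simp
  ultimately show ?thesis
    using spectral_radius_mem_max(2)[of "map_mat complex_of_real A" p "norm (complex_of_real x)"]
    unfolding spectrum_def by (metis image_eqI mem_Collect_eq norm_of_real)
qed

text \<open>Since \<open>A = x (1 - w w^T)\<close> maps into the complement of \<open>w\<close>,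
  pairing an eigenvector with \<open>w\<close> shows that its eigenvalue is 0 or that it is
  orthogonal to \<open>w\<close>, and then the eigenvalue is \<open>x\<close>.\<close>

lemma spectral_radius_scaled_projection:
  fixes w :: "real vec"
  assumes w: "w \<in> carrier_vec p" "w \<bullet> w = 1" and x: "\<bar>x\<bar> < 1"
    and A: "A = mat p p (\<lambda>(r, s). x * ((if r = s then 1 else 0) - w $ r * w $ s))"
  shows "spectral_radius (map_mat complex_of_real A) < 1"
proof -
  let ?A = "map_mat complex_of_real A"
  have carr: "?A \<in> carrier_mat p p" by (simp add: A)
  have "p > 0" using w by (cases p) (auto simp: scalar_prod_def)
  then obtain y where y: "eigenvalue ?A y" "norm y = spectral_radius ?A"
    using spectral_radius_mem_max(1)[OF carr] by (auto simp: spectrum_def)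
  obtain z where z: "z \<in> carrier_vec p" "z \<noteq> 0\<^sub>v p" "?A *\<^sub>v z = y \<cdot>\<^sub>v z"
    using y(1) carr by (auto simp: eigenvalue_def eigenvector_def)
  define h where "h = (\<Sum>s<p. complex_of_real (w $ s) * z $ s)"
  have comp: "complex_of_real x * (z $ r - complex_of_real (w $ r) * h) = y * z $ r" if "r < p" for r
  proof -
    have "y * z $ r = (?A *\<^sub>v z) $ r" using z that by simp
    also have "\<dots> = (\<Sum>s<p. complex_of_real (x * ((if r = s then 1 else 0) - w $ r * w $ s)) * z $ s)"
      using z(1) that by (simp add: A scalar_prod_def atLeast0LessThan)
    also have "\<dots> = (\<Sum>s<p. complex_of_real x *
        ((if s = r then z $ s else 0) - complex_of_real (w $ r) * (complex_of_real (w $ s) * z $ s)))"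
      by (intro sum.cong) (auto simp: algebra_simps)
    also have "\<dots> = complex_of_real x * (z $ r - complex_of_real (w $ r) * h)"
      using that by (simp add: h_def sum_subtractf flip: sum_distrib_left)
    finally show ?thesis by simp
  qed
  have "(\<Sum>s<p. complex_of_real (w $ s) * complex_of_real (w $ s)) = complex_of_real (w \<bullet> w)"
    using w(1) by (simp add: scalar_prod_def atLeast0LessThan)
  hence ww: "(\<Sum>s<p. complex_of_real (w $ s) * complex_of_real (w $ s)) = 1"
    using w(2) by simp
  have "y * h = (\<Sum>r<p. complex_of_real (w $ r) * (y * z $ r))"
    by (simp add: h_def sum_distrib_left mult_ac)
  also have "\<dots> = (\<Sum>r<p. complex_of_real (w $ r) * (complex_of_real x * (z $ r - complex_of_real (w $ r) * h)))"
    using comp by (intro sum.cong) auto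
  also have "\<dots> = (\<Sum>r<p. complex_of_real x * (complex_of_real (w $ r) * z $ r)
      - complex_of_real x * h * (complex_of_real (w $ r) * complex_of_real (w $ r)))"
    by (intro sum.cong) (simp_all add: algebra_simps)
  also have "\<dots> = complex_of_real x * h
      - complex_of_real x * h * (\<Sum>s<p. complex_of_real (w $ s) * complex_of_real (w $ s))"
    by (simp add: sum_subtractf h_def flip: sum_distrib_left)
  finally have "y = 0 \<or> h = 0" using ww by simp
  moreover have "y = complex_of_real x" if "h = 0"
  proof -
    obtain r where "r < p" "z $ r \<noteq> 0" using z by (auto simp: vec_eq_iff)
    thus ?thesis using comp[of r] that by simp
  qed
  ultimately have "norm y < 1" using x by auto
  thus ?thesis using y by simp
qed

section \<open>Analysis and synthesis with the simplex frame\<close>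

locale simplex_frame =
  fixes n :: nat and W :: "real mat"
  assumes n: "n \<ge> 3" and frame: "regular_simplex_frame n W"
begin

definition coord :: "real vec \<Rightarrow> nat \<Rightarrow> real" where
  "coord v i = col W i \<bullet> v"

text \<open>The product of \<open>W\<close> with the column of the first \<open>n\<close> values of
  \<open>b\<close>; \<open>coord v\<close> is the product of the transpose of \<open>W\<close> with
  \<open>v\<close>.\<close>

definition synth :: "(nat \<Rightarrow> real) \<Rightarrow> real vec" where
  "synth b = vec (n - 1) (\<lambda>r. \<Sum>i<n. b i * col W i $ r)"

lemma W_carrier: "W \<in> carrier_mat (n - 1) n"
  using frame by (simp add: regular_simplex_frame_def)

lemma col_carrier [simp]: "col W i \<in> carrier_vec (n - 1)"
  using W_carrier by (metis carrier_matD(1) col_dim)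

lemma synth_carrier [simp]: "synth b \<in> carrier_vec (n - 1)"
  by (simp add: synth_def)

lemma gram:
  assumes "i < n" "j < n"
  shows "col W i \<bullet> col W j = (if i = j then 1 else - 1 / (real n - 1))"
  using assms frame by (auto simp: regular_simplex_frame_def)

lemma row_gram:
  assumes "r < n - 1" "s < n - 1"
  shows "(\<Sum>i<n. col W i $ r * col W i $ s) = (if r = s then real n / (real n - 1) else 0)"
proof -
  have "(W * transpose_mat W) $$ (r, s) = (\<Sum>i<n. col W i $ r * col W i $ s)"
    using assms W_carrier by (simp add: scalar_prod_def atLeast0LessThan)
  moreover have "W * transpose_mat W = (real n / (real n - 1)) \<cdot>\<^sub>m 1\<^sub>m (n - 1)"
    using frame by (simp add: regular_simplex_frame_def)
  ultimately show ?thesis using assms by (auto split: if_splits)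
qed

lemma coord_expand:
  assumes "v \<in> carrier_vec (n - 1)"
  shows "coord v i = (\<Sum>r<n - 1. col W i $ r * v $ r)"
  using assms by (simp add: coord_def scalar_prod_def atLeast0LessThan)

text \<open>The identity \<open>W W^T = n / (n - 1) I\<close> applied to \<open>v\<close>: the frame
  is tight.\<close>

lemma synth_coord:
  assumes v: "v \<in> carrier_vec (n - 1)"
  shows "synth (coord v) = (real n / (real n - 1)) \<cdot>\<^sub>v v"
proof (rule eq_vecI)
  fix r assume "r < dim_vec ((real n / (real n - 1)) \<cdot>\<^sub>v v)"
  hence r: "r < n - 1" using v by simp
  have "synth (coord v) $ r = (\<Sum>i<n. \<Sum>s<n - 1. v $ s * (col W i $ r * col W i $ s))"
    using r v by (auto simp: synth_def coord_expand sum_distrib_left sum_distrib_right mult_ac intro!: sum.cong)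
  also have "\<dots> = (\<Sum>s<n - 1. v $ s * (\<Sum>i<n. col W i $ r * col W i $ s))"
    by (subst sum.swap) (simp add: sum_distrib_left)
  also have "\<dots> = (\<Sum>s<n - 1. if s = r then v $ s * (real n / (real n - 1)) else 0)"
    using r by (intro sum.cong) (auto simp: row_gram)
  finally show "synth (coord v) $ r = ((real n / (real n - 1)) \<cdot>\<^sub>v v) $ r"
    using r v by simp
qed (use v in \<open>simp add: synth_def\<close>)

lemma scalar_prod_synth:
  assumes "v \<in> carrier_vec (n - 1)"
  shows "v \<bullet> synth b = (\<Sum>i<n. b i * coord v i)"
proof -
  have "v \<bullet> synth b = (\<Sum>r<n - 1. \<Sum>i<n. b i * (col W i $ r * v $ r))"
    using assms by (auto simp: scalar_prod_def synth_def atLeast0LessThan sum_distrib_left mult_ac intro!: sum.cong)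
  also have "\<dots> = (\<Sum>i<n. b i * coord v i)"
    using assms by (subst sum.swap) (simp add: coord_expand sum_distrib_left)
  finally show ?thesis .
qed

text \<open>The Gram matrix \<open>W^T W\<close> is \<open>(n I - J) / (n - 1)\<close> with the
  all-ones matrix \<open>J\<close>.\<close>

lemma coord_synth:
  assumes "j < n"
  shows "coord (synth b) j = (real n * b j - (\<Sum>i<n. b i)) / (real n - 1)"
proof -
  have "coord (synth b) j = (\<Sum>i<n. b i * (col W i \<bullet> col W j))"
    using scalar_prod_synth[OF col_carrier, of j b] by (simp add: coord_def)
  also have "\<dots> = (\<Sum>i<n. - b i / (real n - 1) + (if i = j then real n * b i / (real n - 1) else 0))"
    using assms n by (intro sum.cong) (auto simp: gram field_simps)
  also have "\<dots> = (real n * b j - (\<Sum>i<n. b i)) / (real n - 1)"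
    using assms by (simp add: sum.distrib sum_negf sum_subtractf sum_divide_distrib[symmetric] diff_divide_distrib)
  finally show ?thesis .
qed

lemma coord_smult: "v \<in> carrier_vec (n - 1) \<Longrightarrow> coord (x \<cdot>\<^sub>v v) i = x * coord v i"
  unfolding coord_def by (rule scalar_prod_smult_right) (metis carrier_vecD col_carrier)

text \<open>Synthesis of \<open>coord v\<close> multiplies \<open>v\<close> by
  \<open>n / (n - 1)\<close>; by \<open>coord_synth\<close> its coordinates are the same multiple
  minus a share of the sum, which must therefore vanish.\<close>

lemma sum_coord:
  assumes "v \<in> carrier_vec (n - 1)"
  shows "(\<Sum>i<n. coord v i) = 0"
  using coord_synth[of 0 "coord v"] synth_coord[OF assms] coord_smult[OF assms] n
  by (simp add: field_simps)

lemma parseval: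
  assumes "v \<in> carrier_vec (n - 1)" "u \<in> carrier_vec (n - 1)"
  shows "real n / (real n - 1) * (v \<bullet> u) = (\<Sum>i<n. coord v i * coord u i)"
proof -
  have "(\<Sum>i<n. coord v i * coord u i) = u \<bullet> synth (coord v)"
    using assms by (simp add: scalar_prod_synth)
  also have "\<dots> = real n / (real n - 1) * (u \<bullet> v)"
    unfolding synth_coord[OF assms(1)] using assms by simp
  finally show ?thesis using assms by (simp add: comm_scalar_prod[of u])
qed

text \<open>By tightness the coordinates determine a vector, so vector identities can be checked
  coordinatewise.\<close>

lemma coord_inj:
  assumes "v \<in> carrier_vec (n - 1)" "u \<in> carrier_vec (n - 1)" "\<And>i. i < n \<Longrightarrow> coord v i = coord u i"
  shows "v = u"
proof -
  have "synth (coord v) = synth (coord u)"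
    using assms(3) by (simp add: synth_def)
  hence "real n / (real n - 1) * v $ r = real n / (real n - 1) * u $ r" if "r < n - 1" for r
    using that assms unfolding synth_coord[OF assms(1)] synth_coord[OF assms(2)] 
    by (metis carrier_vecD index_smult_vec(1))
  thus ?thesis using assms n by (intro eq_vecI) auto
qed

lemma tensor_vec_simplex:
  assumes v: "v \<in> carrier_vec (n - 1)" and m: "m \<ge> 1"
  shows "tensor_vec m (n - 1) (simplex_tensor m n W) v = synth (\<lambda>i. coord v i ^ (m - 1))"
proof -
  obtain k where k: "m = Suc k" using m by (cases m) auto
  have "(\<Sum>is\<in>tensor_idx k (n - 1). (\<Sum>i<n. col W i $ j * outer_power k (col W i) is) * (\<Prod>l<k. v $ (is ! l)))
      = (\<Sum>i<n. coord v i ^ k * col W i $ j)" for j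
    unfolding sum_distrib_right coord_def sum_outer_power[OF v, symmetric]
    by (subst sum.swap) (simp add: mult_ac)
  thus ?thesis
    by (simp add: tensor_vec_def synth_def simplex_tensor_def k outer_power_Cons)
qed

lemma tensor_mat_simplex:
  assumes v: "v \<in> carrier_vec (n - 1)" and m: "m \<ge> 2"
  shows "tensor_mat m (n - 1) (simplex_tensor m n W) v =
    mat (n - 1) (n - 1) (\<lambda>(r, s). \<Sum>i<n. coord v i ^ (m - 2) * (col W i $ r * col W i $ s))"
proof -
  obtain k where k: "m = Suc (Suc k)" using m by (metis Suc_le_D numeral_2_eq_2 Suc_le_mono)
  have "(\<Sum>is\<in>tensor_idx k (n - 1). (\<Sum>i<n. col W i $ r * (col W i $ s * outer_power k (col W i) is)) * (\<Prod>l<k. v $ (is ! l)))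
      = (\<Sum>i<n. coord v i ^ k * (col W i $ r * col W i $ s))" for r s
    unfolding sum_distrib_right coord_def sum_outer_power[OF v, symmetric]
    by (subst sum.swap) (simp add: mult_ac)
  thus ?thesis
    by (simp add: tensor_mat_def simplex_tensor_def k outer_power_Cons)
qed

end

section \<open>The arithmetic condition for frame vectors to attract\<close>

lemma sum_one_special:
  fixes x y :: real
  assumes "k < n"
  shows "(\<Sum>i<n. if i = k then x else y) = x + (real n - 1) * y"
  using assms by (subst sum.remove[of _ k]) (auto simp: of_nat_diff intro!: sum.cong)

text \<open>Raising \<open>m\<close> by one at most doubles the left side and multiplies the right
  side by \<open>q \<ge> 2\<close>.\<close>

lemma sharp_threshold_aux:
  fixes q m m0 :: nat
  assumes "(m0 - 1) * (q + 1) + 1 < q ^ (m0 - 1)" "m0 \<le> m" "q \<ge> 2" "m0 \<ge> 3"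
  shows "(m - 1) * (q + 1) + 1 < q ^ (m - 1)"
  using assms(2)
proof (induction m rule: dec_induct)
  case (step k)
  then obtain j where j: "k = Suc (Suc j)" using assms(4) by (metis Suc_le_D le_trans numeral_3_eq_3 Suc_le_mono)
  have "(Suc k - 1) * (q + 1) + 1 \<le> 2 * ((k - 1) * (q + 1) + 1)"
    by (simp add: j algebra_simps)
  also have "\<dots> < 2 * q ^ (k - 1)" by (rule mult_strict_left_mono[OF step.IH]) simp
  also have "\<dots> \<le> q ^ (Suc k - 1)" using assms(3) by (simp add: j)
  finally show ?case .
qed (use assms in simp)

text \<open>Here \<open>q\<close> stands for \<open>n - 1\<close>, and the summand 1 absorbs the
  sign in \<open>frame_attracting_iff\<close>. The induction starts at \<open>m = 5\<close>, 4 or 3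
  for \<open>q = 2\<close>, \<open>q = 3\<close> or \<open>q \<ge> 4\<close>.\<close>

lemma sharp_threshold:
  fixes q m :: nat
  assumes "q \<ge> 2" "m \<ge> 3" "(m, q) \<notin> {(3, 2), (3, 3), (4, 2)}"
  shows "(m - 1) * (q + 1) + 1 < q ^ (m - 1)"
proof -
  consider "q = 2" "m \<ge> 5" | "q = 3" "m \<ge> 4" | "q \<ge> 4"
    using assms by fastforce
  thus ?thesis
  proof cases
    case 1
    thus ?thesis using sharp_threshold_aux[of 5 q m] by simp
  next
    case 2
    thus ?thesis using sharp_threshold_aux[of 4 q m] by simp
  next
    case 3
    have "2 * (q + 1) + 1 < 4 * q" using 3 by simp
    also have "4 * q \<le> q * q" using 3 by simp
    finally have "2 * (q + 1) + 1 < q * q" .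
    thus ?thesis using 3 assms sharp_threshold_aux[of 3 q m] by (simp add: power2_eq_square)
  qed
qed

text \<open>The sum of the \<open>m\<close>-th powers of the coordinates of a frame vector: one of
  them is 1 and \<open>n - 1\<close> of them are \<open>- 1 / (n - 1)\<close>.\<close>

definition frame_eigenvalue :: "nat \<Rightarrow> nat \<Rightarrow> real" where
  "frame_eigenvalue m n = 1 - (- 1 / (real n - 1)) ^ (m - 1)"

text \<open>The inequality of \<open>stable_repeated_value\<close> for the repeated coordinate
  \<open>- 1 / (n - 1)\<close> of a frame vector, with
  \<open>L = (n - 1) * frame_eigenvalue m n\<close>.\<close>

definition frame_attracting :: "nat \<Rightarrow> nat \<Rightarrow> bool" where
  "frame_attracting m n \<longleftrightarrow>
    real (m - 1) * n * \<bar>- 1 / (real n - 1)\<bar> ^ (m - 2) < (real n - 1) * frame_eigenvalue m n"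

lemma frame_eigenvalue_pos:
  assumes "n \<ge> 3" "m \<ge> 3"
  shows "frame_eigenvalue m n > 0"
proof -
  have "\<bar>(- 1 / (real n - 1)) ^ (m - 1)\<bar> < 1"
    using assms power_strict_mono[of "\<bar>- 1 / (real n - 1)\<bar>" 1 "m - 1"]
    unfolding power_abs by (simp add: field_simps)
  thus ?thesis unfolding frame_eigenvalue_def by linarith
qed

text \<open>Multiplication by \<open>(n - 1) ^ (m - 2)\<close> clears the denominators and leaves an
  inequality between integers.\<close>

lemma frame_attracting_iff:
  assumes n: "n \<ge> 3" and m: "m \<ge> 3"
  shows "frame_attracting m n \<longleftrightarrow> (m, n) \<notin> {(3, 3), (3, 4), (4, 3)}"
proof -
  define q where "q = n - 1"
  have q: "q \<ge> 2" "real n = real q + 1" "n = Suc q" using n by (auto simp: q_def)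
  obtain k where k: "m = Suc (Suc k)" using m by (metis Suc_le_D numeral_3_eq_3 Suc_le_mono)
  have pos: "real q ^ k > 0" using q by simp
  have sgn: "(- 1 / real q) ^ Suc k * real q ^ Suc k = (- 1) ^ Suc k"
    using q by (simp flip: power_mult_distrib)
  have inv: "(1 / real q) ^ k * real q ^ k = 1"
    using q by (simp flip: power_mult_distrib)
  have "frame_attracting m n \<longleftrightarrow>
      real (Suc k) * (real q + 1) * (1 / real q) ^ k * real q ^ k
        < real q * (1 - (- 1 / real q) ^ Suc k) * real q ^ k"
    using pos by (simp add: frame_attracting_def frame_eigenvalue_def q(2) k mult.assoc)
  also have "real (Suc k) * (real q + 1) * (1 / real q) ^ k * real q ^ k = real (Suc k) * (real q + 1)"
    using inv by (simp only: mult.assoc mult_1_right)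
  also have "real q * (1 - (- 1 / real q) ^ Suc k) * real q ^ k
      = real q ^ Suc k - (- 1 / real q) ^ Suc k * real q ^ Suc k"
    by (simp add: algebra_simps)
  also have "\<dots> = real q ^ Suc k + (- 1) ^ k"
    unfolding sgn by simp
  finally have *: "frame_attracting m n \<longleftrightarrow> real (Suc k) * (real q + 1) < real q ^ Suc k + (- 1) ^ k" .
  show ?thesis
  proof (cases "(m, n) \<in> {(3, 3), (3, 4), (4, 3)}")
    case True
    \<comment> \<open>The inequality reads \<open>6 < 3\<close>, \<open>8 < 8\<close> and
      \<open>9 < 9\<close>: two of the exceptional cases fail only by equality.\<close>
    hence "k = 1 \<and> q = 2 \<or> k = 1 \<and> q = 3 \<or> k = 2 \<and> q = 2" using k q by auto
    thus ?thesis using True * by auto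
  next
    case False
    hence "(m - 1) * (q + 1) + 1 < q ^ (m - 1)"
      using sharp_threshold[of q m] q m by auto
    hence "real (Suc k * (q + 1) + 1) < real (q ^ Suc k)"
      unfolding of_nat_less_iff by (simp add: k)
    hence "real (Suc k) * (real q + 1) + 1 < real q ^ Suc k" by (simp add: algebra_simps)
    moreover have "(- 1) ^ k \<ge> (- 1 :: real)" by (cases "even k") auto
    ultimately have "real (Suc k) * (real q + 1) < real q ^ Suc k + (- 1) ^ k" by linarith
    thus ?thesis using False * by simp
  qed
qed

section \<open>Eigenpairs and the Jacobian in frame coordinates\<close>

declare One_nat_def [simp del]

locale simplex_tensor_power = simplex_frame +
  fixes m :: nat
  assumes m: "m \<ge> 3"
begin

abbreviation S :: tensor where "S \<equiv> simplex_tensor m n W"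

lemma eigenpair_iff:
  "eigenpair m (n - 1) S \<mu> v \<longleftrightarrow>
     v \<in> carrier_vec (n - 1) \<and> synth (\<lambda>i. coord v i ^ (m - 1)) = \<mu> \<cdot>\<^sub>v v \<and> v \<bullet> v = 1"
  using m by (auto simp: eigenpair_def tensor_vec_simplex)

text \<open>In coordinates the eigenvalue equation becomes one polynomial equation, with a constant
  term that does not depend on \<open>j\<close>.\<close>

lemma eigenpair_coord:
  assumes "eigenpair m (n - 1) S \<mu> v" "j < n"
  shows "n * coord v j ^ (m - 1) = (real n - 1) * \<mu> * coord v j + (\<Sum>i<n. coord v i ^ (m - 1))"
proof -
  have "\<mu> * coord v j = (real n * coord v j ^ (m - 1) - (\<Sum>i<n. coord v i ^ (m - 1))) / (real n - 1)"
    using assms coord_synth[of j "\<lambda>i. coord v i ^ (m - 1)"]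
    by (simp add: eigenpair_iff coord_smult)
  thus ?thesis using n by (simp add: field_simps)
qed

lemma eigenpair_value:
  assumes "eigenpair m (n - 1) S \<mu> v"
  shows "\<mu> = (\<Sum>i<n. coord v i ^ m)"
proof -
  have v: "v \<in> carrier_vec (n - 1)" "v \<bullet> v = 1" "synth (\<lambda>i. coord v i ^ (m - 1)) = \<mu> \<cdot>\<^sub>v v"
    using assms by (auto simp: eigenpair_iff)
  have "\<mu> = v \<bullet> synth (\<lambda>i. coord v i ^ (m - 1))"
    using v by simp
  also have "\<dots> = (\<Sum>i<n. coord v i ^ (m - 1) * coord v i)"
    using v(1) by (rule scalar_prod_synth)
  also have "\<dots> = (\<Sum>i<n. coord v i ^ m)"
  proof -
    have "Suc (m - 1) = m" using m by simp
    thus ?thesis by (metis power_Suc2)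
  qed
  finally show ?thesis .
qed

lemma jacobian_carrier: "power_jacobian m (n - 1) S \<mu> v \<in> carrier_mat (n - 1) (n - 1)"
  unfolding power_jacobian_def by (intro smult_carrier_mat minus_carrier_mat mat_carrier)

lemma jacobian_entry:
  assumes "v \<in> carrier_vec (n - 1)" "r < n - 1" "s < n - 1"
  shows "power_jacobian m (n - 1) S \<mu> v $$ (r, s) = (real m - 1) / \<mu> *
    ((\<Sum>i<n. coord v i ^ (m - 2) * (col W i $ r * col W i $ s)) - \<mu> * (v $ r * v $ s))"
  using assms m by (simp add: power_jacobian_def tensor_mat_simplex)

text \<open>Orthogonality to \<open>v\<close> kills the rank-one term of the Jacobian.\<close>

lemma jacobian_mult:
  assumes v: "v \<in> carrier_vec (n - 1)" and u: "u \<in> carrier_vec (n - 1)" and vu: "v \<bullet> u = 0"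
  shows "power_jacobian m (n - 1) S \<mu> v *\<^sub>v u =
    ((real m - 1) / \<mu>) \<cdot>\<^sub>v synth (\<lambda>i. coord v i ^ (m - 2) * coord u i)"
proof (rule eq_vecI)
  fix r assume "r < dim_vec (((real m - 1) / \<mu>) \<cdot>\<^sub>v synth (\<lambda>i. coord v i ^ (m - 2) * coord u i))"
  hence r: "r < n - 1" by (simp add: synth_def)
  have vu': "(\<Sum>s<n - 1. v $ s * u $ s) = 0"
    using vu u by (simp add: scalar_prod_def atLeast0LessThan)
  have "(power_jacobian m (n - 1) S \<mu> v *\<^sub>v u) $ r
      = (\<Sum>s<n - 1. power_jacobian m (n - 1) S \<mu> v $$ (r, s) * u $ s)"
    using r u jacobian_carrier[of \<mu> v] by (simp add: scalar_prod_def atLeast0LessThan)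
  also have "\<dots> = (\<Sum>s<n - 1. (real m - 1) / \<mu> *
      ((\<Sum>i<n. coord v i ^ (m - 2) * (col W i $ r * col W i $ s)) * u $ s - \<mu> * v $ r * (v $ s * u $ s)))"
    using r by (intro sum.cong) (simp_all add: jacobian_entry[OF v] algebra_simps)
  also have "\<dots> = (real m - 1) / \<mu> *
      (\<Sum>s<n - 1. (\<Sum>i<n. coord v i ^ (m - 2) * (col W i $ r * col W i $ s)) * u $ s)"
    by (simp only: sum_subtractf vu' sum_distrib_left[symmetric] mult_zero_right diff_zero)
  also have "(\<Sum>s<n - 1. (\<Sum>i<n. coord v i ^ (m - 2) * (col W i $ r * col W i $ s)) * u $ s)
      = (\<Sum>i<n. coord v i ^ (m - 2) * coord u i * col W i $ r)"
    unfolding coord_expand[OF u] sum_distrib_left sum_distrib_right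
    by (subst sum.swap) (simp add: mult_ac)
  finally show "(power_jacobian m (n - 1) S \<mu> v *\<^sub>v u) $ r
      = (((real m - 1) / \<mu>) \<cdot>\<^sub>v synth (\<lambda>i. coord v i ^ (m - 2) * coord u i)) $ r"
    using r by (simp add: synth_def)
qed (use jacobian_carrier[of \<mu> v] in \<open>auto simp: synth_def\<close>)

text \<open>The vector \<open>synth b\<close> is an eigenvector of the Jacobian for
  \<open>(m - 1) / \<mu> * (n / (n - 1)) * \<theta>\<close>, and robustness bounds the modulus by 1.
  The constant \<open>\<eta>\<close> drops out because \<open>coord_synth\<close> subtracts the
  mean.\<close>

lemma robust_test_vector:
  assumes rob: "robust_eigenpair m (n - 1) S \<mu> v"
    and nz: "\<exists>i<n. b i \<noteq> 0" and b0: "(\<Sum>i<n. b i) = 0" and orth: "(\<Sum>i<n. coord v i * b i) = 0"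
    and eig: "\<And>i. i < n \<Longrightarrow> coord v i ^ (m - 2) * b i = \<theta> * b i + \<eta>"
  shows "real (m - 1) * n * \<bar>\<theta>\<bar> < (real n - 1) * \<mu>"
proof -
  have v: "v \<in> carrier_vec (n - 1)" and mu: "\<mu> > 0"
    and rho: "spectral_radius (map_mat complex_of_real (power_jacobian m (n - 1) S \<mu> v)) < 1"
    using rob by (auto simp: robust_eigenpair_def eigenpair_def)
  define u where "u = synth b"
  have u: "u \<in> carrier_vec (n - 1)" by (simp add: u_def)
  have cu: "coord u i = real n / (real n - 1) * b i" if "i < n" for i
    using that b0 by (simp add: u_def coord_synth)
  have vu: "v \<bullet> u = 0"
    using orth by (simp add: u_def scalar_prod_synth[OF v] mult.commute)
  define x where "x = real n / (real n - 1) * \<theta>"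
  have "synth (\<lambda>i. coord v i ^ (m - 2) * coord u i) = x \<cdot>\<^sub>v u"
  proof (rule coord_inj)
    fix j assume j: "j < n"
    let ?c = "real n / (real n - 1)"
    have e: "coord v i ^ (m - 2) * coord u i = x * b i + ?c * \<eta>" if "i < n" for i
    proof -
      have "coord v i ^ (m - 2) * coord u i = ?c * (coord v i ^ (m - 2) * b i)"
        by (simp add: cu[OF that])
      thus ?thesis unfolding eig[OF that] by (simp add: x_def algebra_simps add_divide_distrib)
    qed
    have "(\<Sum>i<n. coord v i ^ (m - 2) * coord u i) = (\<Sum>i<n. x * b i + ?c * \<eta>)"
      using e by (intro sum.cong) auto
    also have "\<dots> = real n * (?c * \<eta>)"
      using b0 by (simp add: sum.distrib flip: sum_distrib_left)
    finally have sum: "(\<Sum>i<n. coord v i ^ (m - 2) * coord u i) = real n * (?c * \<eta>)" .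
    show "coord (synth (\<lambda>i. coord v i ^ (m - 2) * coord u i)) j = coord (x \<cdot>\<^sub>v u) j"
      unfolding coord_synth[OF j] coord_smult[OF u] sum e[OF j] unfolding cu[OF j]
      by (simp add: algebra_simps)
  qed (use u in simp_all)
  hence "power_jacobian m (n - 1) S \<mu> v *\<^sub>v u = ((real m - 1) / \<mu> * x) \<cdot>\<^sub>v u"
    by (simp add: jacobian_mult[OF v u vu] smult_smult_assoc)
  moreover have "u \<noteq> 0\<^sub>v (n - 1)"
  proof
    assume "u = 0\<^sub>v (n - 1)"
    hence "coord u i = 0" for i by (simp add: coord_def)
    thus False using nz cu n by auto
  qed
  ultimately have "\<bar>(real m - 1) / \<mu> * x\<bar> < 1"
    using eigenvalue_norm_le_spectral_radius[OF jacobian_carrier u] rho by fastforce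
  hence "(real m - 1) * n * \<bar>\<theta>\<bar> < (real n - 1) * \<mu>"
    using mu n m by (simp add: x_def abs_mult abs_divide field_simps)
  thus ?thesis using m by (simp add: of_nat_diff)
qed

lemma coord_frame:
  assumes "k < n" "i < n"
  shows "coord (col W k) i = (if i = k then 1 else - 1 / (real n - 1))"
  using assms by (simp add: coord_def gram)

lemma frame_eigenpair:
  assumes k: "k < n"
  shows "eigenpair m (n - 1) S (frame_eigenvalue m n) (col W k)"
proof -
  define B where "B = (- 1 / (real n - 1)) ^ (m - 1)"
  have pw: "coord (col W k) i ^ (m - 1) = (if i = k then 1 else B)" if "i < n" for i
    using that k by (simp add: coord_frame B_def)
  have sum: "(\<Sum>i<n. coord (col W k) i ^ (m - 1)) = 1 + (real n - 1) * B"
    using pw sum_one_special[OF k, of 1 B] by simp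
  have "synth (\<lambda>i. coord (col W k) i ^ (m - 1)) = frame_eigenvalue m n \<cdot>\<^sub>v col W k"
  proof (rule coord_inj)
    fix j assume j: "j < n"
    define q where "q = real n - 1"
    have q: "q > 0" "real n = q + 1" using n by (auto simp: q_def)
    have "(real n * (if j = k then 1 else B) - (1 + (real n - 1) * B)) / (real n - 1)
        = (1 - B) * (if j = k then 1 else - 1 / (real n - 1))"
      using q(1) unfolding q(2) by (simp add: field_simps)
    thus "coord (synth (\<lambda>i. coord (col W k) i ^ (m - 1))) j
        = coord (frame_eigenvalue m n \<cdot>\<^sub>v col W k) j"
      unfolding coord_synth[OF j] coord_smult[OF col_carrier] sum pw[OF j]
      unfolding coord_frame[OF k j] frame_eigenvalue_def B_def .
  qed simp_all
  thus ?thesis using gram[OF k k] by (simp add: eigenpair_iff)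
qed

lemma frame_robust:
  assumes k: "k < n" and attr: "frame_attracting m n"
  shows "robust_eigenpair m (n - 1) S (frame_eigenvalue m n) (col W k)"
proof -
  let ?w = "col W k" and ?e = "frame_eigenvalue m n"
  have e: "?e > 0" using n m by (rule frame_eigenvalue_pos)
  define B where "B = (- 1 / (real n - 1)) ^ (m - 2)"
  have "m - 1 = Suc (m - 2)" using m by simp
  hence ev: "?e = 1 + B / (real n - 1)"
    by (simp add: frame_eigenvalue_def B_def)
  define x where "x = (real m - 1) / ?e * (B * (real n / (real n - 1)))"
  have factor: "d * (B * (if P then c else 0) + - (B * c) * y) = d * (B * c) * ((if P then 1 else 0) - y)"
    for c d y :: real and P
    by (simp add: algebra_simps)
  have "power_jacobian m (n - 1) S ?e ?w
      = mat (n - 1) (n - 1) (\<lambda>(r, s). x * ((if r = s then 1 else 0) - ?w $ r * ?w $ s))"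
  proof (rule eq_matI)
    fix r s
    assume "r < dim_row (mat (n - 1) (n - 1) (\<lambda>(r, s). x * ((if r = s then 1 else 0) - ?w $ r * ?w $ s)))"
      and "s < dim_col (mat (n - 1) (n - 1) (\<lambda>(r, s). x * ((if r = s then 1 else 0) - ?w $ r * ?w $ s)))"
    hence rs: "r < n - 1" "s < n - 1" by auto
    \<comment> \<open>The powers equal \<open>B\<close> except for the 1 at index \<open>k\<close>.
      Writing this 1 as \<open>B + (1 - B)\<close> gives \<open>B\<close> times an entry of
      \<open>W W^T\<close> plus a rank-one term.\<close>
    have "(\<Sum>i<n. coord ?w i ^ (m - 2) * (col W i $ r * col W i $ s))
        = (\<Sum>i<n. B * (col W i $ r * col W i $ s) + (if i = k then (1 - B) * (?w $ r * ?w $ s) else 0))"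
      using k by (intro sum.cong) (auto simp: coord_frame B_def algebra_simps)
    also have "\<dots> = B * (if r = s then real n / (real n - 1) else 0) + (1 - B) * (?w $ r * ?w $ s)"
      using k by (simp add: sum.distrib row_gram[OF rs] flip: sum_distrib_left)
    finally have T: "(\<Sum>i<n. coord ?w i ^ (m - 2) * (col W i $ r * col W i $ s)) = \<dots>" .
    have "power_jacobian m (n - 1) S ?e ?w $$ (r, s) = (real m - 1) / ?e *
        (B * (if r = s then real n / (real n - 1) else 0) + (1 - B - ?e) * (?w $ r * ?w $ s))"
      unfolding jacobian_entry[OF col_carrier rs] T
      by (simp only: left_diff_distrib add_diff_eq mult_1_left)
    also have "1 - B - ?e = - (B * (real n / (real n - 1)))"
      using n by (simp add: ev field_simps)
    also have "(real m - 1) / ?e * (B * (if r = s then real n / (real n - 1) else 0)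
          + - (B * (real n / (real n - 1))) * (?w $ r * ?w $ s))
        = x * ((if r = s then 1 else 0) - ?w $ r * ?w $ s)"
      unfolding x_def by (rule factor)
    finally show "power_jacobian m (n - 1) S ?e ?w $$ (r, s)
      = mat (n - 1) (n - 1) (\<lambda>(r, s). x * ((if r = s then 1 else 0) - ?w $ r * ?w $ s)) $$ (r, s)"
      using rs by simp
  qed (use jacobian_carrier[of ?e ?w] in auto)
  moreover have "\<bar>x\<bar> < 1"
  proof -
    have "(real m - 1) * n * \<bar>B\<bar> < (real n - 1) * ?e"
      using attr m unfolding frame_attracting_def B_def power_abs by (simp add: of_nat_diff)
    moreover have "(real n - 1) * ?e > 0" using e n by simp
    moreover have "\<bar>x\<bar> = (real m - 1) * n * \<bar>B\<bar> / ((real n - 1) * ?e)"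
      using e n m by (simp add: x_def abs_mult mult_ac)
    ultimately show ?thesis by (simp only: divide_less_eq_1_pos)
  qed
  moreover have "?w \<bullet> ?w = 1" using gram[OF k k] by simp
  ultimately have "spectral_radius (map_mat complex_of_real (power_jacobian m (n - 1) S ?e ?w)) < 1"
    using spectral_radius_scaled_projection[OF col_carrier] by blast
  thus ?thesis using frame_eigenpair[OF k] e by (simp add: robust_eigenpair_def)
qed

lemma robust_imp_frame:
  assumes rob: "robust_eigenpair m (n - 1) S \<mu> v"
  shows "frame_attracting m n \<and>
    (\<exists>k<n. sign_equivalent m (\<mu>, v) (frame_eigenvalue m n, col W k))"
proof -
  let ?a = "coord v" and ?L = "(real n - 1) * \<mu>" and ?c = "\<Sum>i<n. coord v i ^ (m - 1)"
  have v: "v \<in> carrier_vec (n - 1)" "v \<bullet> v = 1" and ep: "eigenpair m (n - 1) S \<mu> v" and mu: "\<mu> > 0"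
    using rob by (auto simp: robust_eigenpair_def eigenpair_def)
  have L: "?L > 0" using mu n by simp
  have sum0: "(\<Sum>i<n. ?a i) = 0" by (rule sum_coord[OF v(1)])
  have sq: "(\<Sum>i<n. ?a i * ?a i) = real n / (real n - 1)"
    using parseval[OF v(1) v(1)] v(2) by simp
  have nz: "\<exists>i<n. ?a i \<noteq> 0"
  proof (rule ccontr)
    assume "\<not> ?thesis"
    hence "(\<Sum>i<n. ?a i * ?a i) = 0" by simp
    thus False using sq n by simp
  qed
  interpret coords: stable_values n m ?L ?c ?a
  proof
    fix b \<theta> \<eta>
    assume "\<exists>i<n. b i \<noteq> 0" "(\<Sum>i<n. b i) = 0" "(\<Sum>i<n. ?a i * b i) = 0"
      "\<And>i. i < n \<Longrightarrow> ?a i ^ (m - 2) * b i = \<theta> * b i + \<eta>"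
    thus "real (m - 1) * n * \<bar>\<theta>\<bar> < ?L"
      by (rule robust_test_vector[OF rob])
  qed (use n m L sum0 nz eigenpair_coord[OF ep] in auto)
  obtain k where k: "k < n" "\<forall>i<n. i \<noteq> k \<longrightarrow> ?a i = - ?a k / (real n - 1)"
    using coords.stable_configuration by blast
  \<comment> \<open>The coordinates of \<open>v\<close> are \<open>\<alpha>\<close> times those of
    \<open>col W k\<close>; comparing norms yields \<open>\<alpha> = 1\<close> or
    \<open>\<alpha> = - 1\<close>.\<close>
  define \<alpha> where "\<alpha> = ?a k"
  have a: "?a i = \<alpha> * coord (col W k) i" if "i < n" for i
    using k that by (cases "i = k") (simp_all add: coord_frame \<alpha>_def)
  have "(\<Sum>i<n. ?a i * ?a i) = (\<alpha>)\<^sup>2 * (\<Sum>i<n. coord (col W k) i * coord (col W k) i)"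
    unfolding sum_distrib_left
  proof (intro sum.cong refl)
    fix i assume "i \<in> {..<n}"
    hence "?a i = \<alpha> * coord (col W k) i" by (intro a) simp
    thus "?a i * ?a i = \<alpha>\<^sup>2 * (coord (col W k) i * coord (col W k) i)"
      by (simp only: power2_eq_square mult_ac)
  qed
  also have "(\<Sum>i<n. coord (col W k) i * coord (col W k) i) = real n / (real n - 1)"
    using parseval[OF col_carrier col_carrier, of k k] gram[OF k(1) k(1)] by simp
  finally have "(\<alpha>)\<^sup>2 = 1" using sq n by simp
  hence ak: "\<alpha> = 1 \<or> \<alpha> = - 1" by (simp add: power2_eq_1_iff)
  have vk: "v = \<alpha> \<cdot>\<^sub>v col W k"
    using v(1) a by (intro coord_inj) (auto simp: coord_smult)
  have "\<mu> = (\<Sum>i<n. \<alpha> ^ m * coord (col W k) i ^ m)"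
    unfolding eigenpair_value[OF ep]
  proof (intro sum.cong refl)
    fix i assume "i \<in> {..<n}"
    hence "?a i = \<alpha> * coord (col W k) i" by (intro a) simp
    thus "?a i ^ m = \<alpha> ^ m * coord (col W k) i ^ m" by (simp only: power_mult_distrib)
  qed
  hence val: "\<mu> = \<alpha> ^ m * frame_eigenvalue m n"
    unfolding eigenpair_value[OF frame_eigenpair[OF k(1)]] by (simp add: sum_distrib_left)
  have e: "frame_eigenvalue m n > 0" using n m by (rule frame_eigenvalue_pos)
  \<comment> \<open>For odd \<open>m\<close> the sign \<open>\<alpha> = - 1\<close> would make
    \<open>\<mu>\<close> negative.\<close>
  have par: "\<alpha> = 1 \<or> \<alpha> = - 1 \<and> even m"
  proof (rule ccontr)
    assume "\<not> ?thesis"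
    hence "\<mu> = - frame_eigenvalue m n" using ak val by auto
    thus False using mu e by simp
  qed
  hence \<mu>: "\<mu> = frame_eigenvalue m n" using val by auto
  have "sign_equivalent m (\<mu>, v) (frame_eigenvalue m n, col W k)"
    using par
  proof
    assume "\<alpha> = 1"
    thus ?thesis using \<mu> vk by (simp add: sign_equivalent_def)
  next
    assume *: "\<alpha> = - 1 \<and> even m"
    have "col W k = - v"
    proof (rule eq_vecI)
      fix r assume "r < dim_vec (- v)"
      hence r: "r < dim_vec (col W k)" using v(1) carrier_vecD[OF col_carrier, of k] by simp
      have "v $ r = \<alpha> * col W k $ r" by (subst vk) (simp only: index_smult_vec(1)[OF r])
      thus "col W k $ r = (- v) $ r" using * r \<open>r < dim_vec (- v)\<close> by simp
    qed (use v(1) carrier_vecD[OF col_carrier, of k] in simp)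
    thus ?thesis using \<mu> * m by (simp add: sign_equivalent_def)
  qed
  moreover have "frame_attracting m n"
  proof -
    \<comment> \<open>As \<open>n \<ge> 3\<close>, two indices differ from \<open>k\<close>; their
      common coordinate is a repeated value, so its stability bound is the attraction
      condition.\<close>
    obtain i j where ij: "i < n" "j < n" "i \<noteq> j" "i \<noteq> k" "j \<noteq> k"
    proof -
      consider "k = 0" | "k = 1" | "k \<ge> 2" by linarith
      thus ?thesis using that[of 1 2] that[of 0 2] that[of 0 1] n by cases auto
    qed
    have "real (m - 1) * n * \<bar>?a i\<bar> ^ (m - 2) < ?L"
      by (rule coords.stable_repeated_value[of i j]) (use ij k in auto)
    moreover have "\<bar>?a i\<bar> = \<bar>- 1 / (real n - 1)\<bar>"
      using ak a[of i] k(1) ij by (auto simp: coord_frame)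
    ultimately show ?thesis unfolding frame_attracting_def \<mu> by simp
  qed
  ultimately show ?thesis using k(1) by blast
qed

end

theorem theorem14:
  fixes m n :: nat and W :: "real mat"
  assumes "n \<ge> 3" and "m \<ge> 3"
    and "regular_simplex_frame n W"
  defines "S \<equiv> simplex_tensor m n W"
  shows "((m, n) \<in> {(3, 3), (3, 4), (4, 3)} \<longrightarrow>
            \<not> (\<exists>\<mu> v. robust_eigenpair m (n - 1) S \<mu> v)) \<and>
         ((m, n) \<notin> {(3, 3), (3, 4), (4, 3)} \<longrightarrow>
            (\<forall>i<n. robust_eigenvector m (n - 1) S (col W i)) \<and>
            (\<forall>\<mu> v. robust_eigenpair m (n - 1) S \<mu> v \<longrightarrow>
               (\<exists>i<n. \<exists>\<nu>. robust_eigenpair m (n - 1) S \<nu> (col W i) \<and>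
                      sign_equivalent m (\<mu>, v) (\<nu>, col W i))))"
proof -
  interpret simplex_tensor_power n W m
    using assms by unfold_locales
  note attr = frame_attracting_iff[OF assms(1,2)]
  show ?thesis
    unfolding S_def robust_eigenvector_def
    using attr frame_robust robust_imp_frame by blast
qed

end
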